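(* Let $W$ and $\widetilde W$ be weight matrices of size $N$ supported on the same interval such that $\widetilde W$ is a strong Darboux transformation of $W$. If $\mathcal V$ is a strong Darboux transformer from $W$ to $\widetilde W$, with $\mathcal N=\widetilde W\mathcal V^{\ast}W^{-1}$ and $D=\mathcal V\mathcal N\in\mathcal D(W)$, then $$\mathcal V\,\mathcal S(\widetilde W)\,\mathcal N\subset\mathcal S(W).$$
   Context: A weight matrix of size $N$ on an interval $(x_0,x_1)\subseteq\mathbb R$ is a smooth function $W:(x_0,x_1)\to\operatorname{Mat}_N(\mathbb C)$ that is positive definite almost everywhere and has finite moments of all orders. Standing assumption on all weight matrices: for each $n\ge 0$ the derivative $W^{(n)}(x)$ decreases exponentially at infinity and there is a (nonzero) scalar polynomial $p_n$ such that $W^{(n)}p_n$ has finite moments. Put $\langle P,Q\rangle_W=\int_{x_0}^{x_1}P(x)W(x)Q(x)^*\,dx$ for $P,Q\in\operatorname{Mat}_N(\mathbb C[x])$. The monic orthogonal polynomials of $W$ are the unique $P_n\in\operatorname{Mat}_N(\mathbb C[x])$, $n\ge0$, of degree $n$ with leading coefficient $I$ and $\langle P_n,P_m\rangle_W=0$ for $n\ne m$. Differential operators $D=\sum_{i=0}^s\partial^iF_i(x)$, $\partial=d/dx$, act on the right on matrix functions: $P\cdot D=\sum_i P^{(i)}F_i$, and products satisfy $P\cdot(D_1D_2)=(P\cdot D_1)\cdot D_2$. $\operatorname{Mat}_N(\Omega[x])$ is the algebra of such operators with coefficients $F_i\in\operatorname{Mat}_N(\mathbb C[x])$. $$\mathcal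 D(W)=\{D\in\operatorname{Mat}_N(\Omega[x]): P_n\cdot D=\Lambda_n(D)P_n\text{ for some }\Lambda_n(D)\in\operatorname{Mat}_N(\mathbb C),\ \forall n\ge0\}.$$ An operator $D\in\mathcal D(W)$ is $W$-symmetric if $\langle P\cdot D,Q\rangle_W=\langle P,Q\cdot D\rangle_W$ for all $P,Q\in\operatorname{Mat}_N(\mathbb C[x])$; $\mathcal S(W)$ is the set of all $W$-symmetric operators in $\mathcal D(W)$. The formal adjoint ${}^*$ is the involution (reversing products) extending the Hermitian conjugate on matrix functions and sending $\partial I$ to $-\partial I$; thus for $\mathcal V=\sum_j\partial^jF_j$ and $\mathcal N=\widetilde W\mathcal V^*W^{-1}$ one has $Q\cdot\mathcal N=\sum_j(-1)^j(Q\widetilde WF_j^* )^{(j)}W^{-1}$. An operator $\mathcal V\in\operatorname{Mat}_N(\Omega[x])$ is degree-preserving if $\deg(P\cdot\mathcal V)=\deg P$ for all $P\in\operatorname{Mat}_N(\mathbb C[x])$. Strong Darboux transformation: $\widetilde W$ is a strong Darboux transformation of $W$ (both of size $N$ on the same interval) if there is a degree-preserving differential operator $\mathcal V\in\operatorname{Mat}_N(\Omega[x])$ with nonsingular leading coefficient (i.e. the coefficient of its highest power of $\partial$ is a matrix polynomial whose determinant is not identically zero) such that $D=\mathcal V\mathcal N\in\mathcal D(W)$, where $\mathcal N=\widetilde W\mathcal V^*W^{-1}$ is a differential operator satisfying $\langle P\cdot\mathcal V,Q\rangle_{\widetilde W}=\langle P,Q\cdot\mathcal N\rangle_W$ for all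 $P,Q\in\operatorname{Mat}_N(\mathbb C[x])$. Such a $\mathcal V$ is called a strong Darboux transformer from $W$ to $\widetilde W$. *)

theory Defs
  imports "HOL-Analysis.Analysis" "HOL-Computational_Algebra.Polynomial"
    "HOL-Library.Function_Algebras" "HOL-Library.Landau_Symbols"
begin

section \<open>Matrix polynomials\<close>

text \<open>\<open>Mat\<^sub>N(\<complex>)\<close>, \<open>Mat\<^sub>N(\<complex>[x])\<close> and matrix functions; the size \<open>N\<close> is \<open>CARD('n)\<close>.
  The matrix product is \<open>**\<close> throughout: \<open>*\<close> on \<open>vec\<close> is entrywise and is never used here.\<close>

type_synonym 'n cmat = "complex^'n^'n"
type_synonym 'n pmat = "complex poly^'n^'n"
type_synonym 'n fmat = "real \<Rightarrow> complex^'n^'n"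

definition hadj :: "'n::finite cmat \<Rightarrow> 'n cmat" where
  "hadj A = map_matrix cnj (transpose A)"

definition pos_def :: "'n::finite cmat \<Rightarrow> bool" where
  "pos_def A \<longleftrightarrow> hadj A = A \<and>
     (\<forall>v. v \<noteq> 0 \<longrightarrow> 0 < Re (\<Sum>i\<in>UNIV. \<Sum>j\<in>UNIV. cnj (v $ i) * A $ i $ j * v $ j))"

definition mconst :: "'n::finite cmat \<Rightarrow> 'n pmat" where
  "mconst A = map_matrix (\<lambda>c. [:c:]) A"

definition meval :: "'n::finite pmat \<Rightarrow> 'n fmat" where
  "meval P x = map_matrix (\<lambda>p. poly p (complex_of_real x)) P"

definition mcoeff :: "'n::finite pmat \<Rightarrow> nat \<Rightarrow> 'n cmat" where
  "mcoeff P k = map_matrix (\<lambda>p. coeff p k) P"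

text \<open>As for \<open>degree\<close>, the zero polynomial gets degree \<open>0\<close>.\<close>

definition mdegree :: "'n::finite pmat \<Rightarrow> nat" where
  "mdegree P = Max (range (\<lambda>(i, j). degree (P $ i $ j)))"

definition mpderiv :: "'n::finite pmat \<Rightarrow> 'n pmat" where
  "mpderiv P = map_matrix pderiv P"


section \<open>Differential operators acting on the right\<close>

definition vderiv :: "(real \<Rightarrow> 'a::real_normed_vector) \<Rightarrow> real \<Rightarrow> 'a" where
  "vderiv f x = vector_derivative f (at x)"

definition smooth_on :: "real set \<Rightarrow> (real \<Rightarrow> 'a::real_normed_vector) \<Rightarrow> bool" where
  "smooth_on U f \<longleftrightarrow> (\<forall>n. \<forall>x\<in>U. (vderiv ^^ n) f differentiable (at x))"

text \<open>An operator \<open>\<Sum>i. \<partial>\<^sup>i F\<^sub>i\<close> is the finite sequence of its coefficients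
  \<open>coeff D i = F\<^sub>i\<close>. The type \<open>poly\<close> serves only as the type of finitely supported
  sequences; its multiplication is not the product of operators.
  \<open>'n pdop\<close> is \<open>Mat\<^sub>N(\<Omega>[x])\<close>; \<open>'n fdop\<close> allows arbitrary functions as coefficients, which
  is needed for \<open>W\<^sup>~ V\<^sup>* W\<^sup>-\<^sup>1\<close>.\<close>

type_synonym 'n pdop = "(complex poly^'n^'n) poly"
type_synonym 'n fdop = "(real \<Rightarrow> complex^'n^'n) poly"

definition pdop_act :: "'n::finite pmat \<Rightarrow> 'n pdop \<Rightarrow> 'n pmat" where
  "pdop_act P D = (\<Sum>i\<le>degree D. (mpderiv ^^ i) P ** coeff D i)"

definition fdop_act :: "'n::finite fmat \<Rightarrow> 'n fdop \<Rightarrow> 'n fmat" where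
  "fdop_act f D = (\<lambda>x. \<Sum>i\<le>degree D. (vderiv ^^ i) f x ** coeff D i x)"

definition fdop :: "'n::finite pdop \<Rightarrow> 'n fdop" where
  "fdop D = map_poly meval D"

text \<open>The product determined by \<open>f \<cdot> (D E) = (f \<cdot> D) \<cdot> E\<close>: by the Leibniz rule
  \<open>(\<partial>\<^sup>i F)(\<partial>\<^sup>j G) = (\<Sum>k\<le>j. \<partial>\<^sup>i\<^sup>+\<^sup>k (j choose k) F\<^sup>(\<^sup>j\<^sup>-\<^sup>k\<^sup>) G)\<close>; see \<open>fdop_act_dmult\<close> below.\<close>

definition dmult :: "'n::finite fdop \<Rightarrow> 'n fdop \<Rightarrow> 'n fdop"  (infixl \<open>\<odot>\<close> 70) where
  "D \<odot> E = (\<Sum>i\<le>degree D. \<Sum>j\<le>degree E. \<Sum>k\<le>j.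
     monom (\<lambda>x. real (j choose k) *\<^sub>R ((vderiv ^^ (j - k)) (coeff D i) x ** coeff E j x)) (i + k))"

text \<open>The operator of order zero given by a matrix function.\<close>

definition mulop :: "'n::finite fmat \<Rightarrow> 'n fdop" where
  "mulop F = monom F 0"

text \<open>\<open>(\<Sum>j. \<partial>\<^sup>j F\<^sub>j)\<^sup>* = (\<Sum>j. F\<^sub>j\<^sup>* (-\<partial>)\<^sup>j)\<close>.\<close>

definition formal_adjoint :: "'n::finite fdop \<Rightarrow> 'n fdop" where
  "formal_adjoint D =
     (\<Sum>j\<le>degree D. mulop (\<lambda>x. hadj (coeff D j x)) \<odot> monom (\<lambda>x. (-1) ^ j *\<^sub>R mat 1) j)"

definition dop_eq_on :: "real set \<Rightarrow> 'n::finite fdop \<Rightarrow> 'n fdop \<Rightarrow> bool" where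
  "dop_eq_on U D E \<longleftrightarrow> (\<forall>k. \<forall>x\<in>U. coeff D k x = coeff E k x)"

text \<open>The conjunct \<open>pdop_act P D = 0 \<longleftrightarrow> P = 0\<close> accounts for the convention \<open>deg 0 = -\<infinity>\<close>:
  a nonzero constant must not be sent to \<open>0\<close>.\<close>

definition degree_preserving :: "'n::finite pdop \<Rightarrow> bool" where
  "degree_preserving D \<longleftrightarrow> (\<forall>P. mdegree (pdop_act P D) = mdegree P \<and> (pdop_act P D = 0 \<longleftrightarrow> P = 0))"


section \<open>Weight matrices\<close>

definition mintegrable :: "ereal \<Rightarrow> ereal \<Rightarrow> 'n::finite fmat \<Rightarrow> bool" where
  "mintegrable x0 x1 f \<longleftrightarrow> set_integrable lborel (einterval x0 x1) f"

definition finite_moments :: "ereal \<Rightarrow> ereal \<Rightarrow> 'n::finite fmat \<Rightarrow> bool" where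
  "finite_moments x0 x1 f \<longleftrightarrow> (\<forall>k. mintegrable x0 x1 (\<lambda>x. x ^ k *\<^sub>R f x))"

text \<open>Exponential decrease at those endpoints of the interval that are infinite.\<close>

definition exp_decreasing :: "ereal \<Rightarrow> ereal \<Rightarrow> 'n::finite fmat \<Rightarrow> bool" where
  "exp_decreasing x0 x1 f \<longleftrightarrow>
     (x1 = \<infinity> \<longrightarrow> (\<exists>c>0. (\<lambda>x. norm (f x)) \<in> O[at_top](\<lambda>x. exp (- c * x)))) \<and>
     (x0 = -\<infinity> \<longrightarrow> (\<exists>c>0. (\<lambda>x. norm (f x)) \<in> O[at_bot](\<lambda>x. exp (c * x))))"

text \<open>The last conjunct contains the standing assumptions on the derivatives of \<open>W\<close>.
  Values of \<open>W\<close> outside the interval play no role.\<close>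

definition weight_matrix :: "ereal \<Rightarrow> ereal \<Rightarrow> 'n::finite fmat \<Rightarrow> bool" where
  "weight_matrix x0 x1 W \<longleftrightarrow>
     x0 < x1 \<and>
     smooth_on (einterval x0 x1) W \<and>
     (AE x in lborel. x \<in> einterval x0 x1 \<longrightarrow> pos_def (W x)) \<and>
     finite_moments x0 x1 W \<and>
     (\<forall>n. exp_decreasing x0 x1 ((vderiv ^^ n) W) \<and>
       (\<exists>p :: complex poly. p \<noteq> 0 \<and>
         finite_moments x0 x1
           (\<lambda>x. map_matrix (\<lambda>z. poly p (complex_of_real x) * z) ((vderiv ^^ n) W x))))"

definition inner_integrand :: "'n::finite fmat \<Rightarrow> 'n fmat \<Rightarrow> 'n fmat \<Rightarrow> 'n fmat" where
  "inner_integrand W P Q = (\<lambda>x. P x ** W x ** hadj (Q x))"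

definition winner :: "ereal \<Rightarrow> ereal \<Rightarrow> 'n::finite fmat \<Rightarrow> 'n fmat \<Rightarrow> 'n fmat \<Rightarrow> 'n cmat" where
  "winner x0 x1 W P Q = (LINT x:einterval x0 x1|lborel. inner_integrand W P Q x)"

text \<open>For a weight matrix there is exactly one such sequence.\<close>

definition monic_orthogonal :: "ereal \<Rightarrow> ereal \<Rightarrow> 'n::finite fmat \<Rightarrow> (nat \<Rightarrow> 'n pmat) \<Rightarrow> bool" where
  "monic_orthogonal x0 x1 W P \<longleftrightarrow>
     (\<forall>n. mdegree (P n) = n \<and> mcoeff (P n) n = mat 1) \<and>
     (\<forall>m n. m \<noteq> n \<longrightarrow> winner x0 x1 W (meval (P n)) (meval (P m)) = 0)"

definition alg_D :: "ereal \<Rightarrow> ereal \<Rightarrow> 'n::finite fmat \<Rightarrow> 'n pdop set" where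
  "alg_D x0 x1 W = {D. \<exists>P. monic_orthogonal x0 x1 W P \<and>
     (\<forall>n. \<exists>\<Lambda>. pdop_act (P n) D = mconst \<Lambda> ** P n)}"

definition sym_ops :: "ereal \<Rightarrow> ereal \<Rightarrow> 'n::finite fmat \<Rightarrow> 'n pdop set" where
  "sym_ops x0 x1 W = {D \<in> alg_D x0 x1 W. \<forall>P Q.
     winner x0 x1 W (meval (pdop_act P D)) (meval Q) = winner x0 x1 W (meval P) (meval (pdop_act Q D))}"


section \<open>Strong Darboux transformations\<close>

text \<open>\<open>N = W\<^sup>~ V\<^sup>* W\<^sup>-\<^sup>1\<close>; its action is computed in \<open>fdop_act_darboux_N\<close>. Its coefficients are meaningful on \<open>reg_set x0 x1 W\<close>, an open set of full
  measure in the interval if \<open>W\<close> is a weight matrix. Identities between operators that involve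
  \<open>W\<^sup>-\<^sup>1\<close> are therefore read on that set.\<close>

definition reg_set :: "ereal \<Rightarrow> ereal \<Rightarrow> 'n::finite fmat \<Rightarrow> real set" where
  "reg_set x0 x1 W = {x \<in> einterval x0 x1. invertible (W x)}"

definition darboux_N :: "'n::finite fmat \<Rightarrow> 'n fmat \<Rightarrow> 'n pdop \<Rightarrow> 'n fdop" where
  "darboux_N W Wt V = mulop Wt \<odot> formal_adjoint (fdop V) \<odot> mulop (\<lambda>x. matrix_inv (W x))"

text \<open>Membership, in a set of operators with polynomial coefficients, of an operator whose
  coefficients are given as functions on \<open>U\<close>.\<close>

definition dop_mem_on :: "real set \<Rightarrow> 'n::finite fdop \<Rightarrow> 'n pdop set \<Rightarrow> bool" where
  "dop_mem_on U L \<A> \<longleftrightarrow> (\<exists>D\<in>\<A>. dop_eq_on U L (fdop D))"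

text \<open>The first conjunct under the quantifier says that the integral on the right converges.\<close>

definition strong_darboux_transformer ::
    "ereal \<Rightarrow> ereal \<Rightarrow> 'n::finite fmat \<Rightarrow> 'n fmat \<Rightarrow> 'n pdop \<Rightarrow> bool" where
  "strong_darboux_transformer x0 x1 W Wt V \<longleftrightarrow>
     degree_preserving V \<and>
     det (lead_coeff V) \<noteq> 0 \<and>
     dop_mem_on (reg_set x0 x1 W) (fdop V \<odot> darboux_N W Wt V) (alg_D x0 x1 W) \<and>
     (\<forall>P Q. mintegrable x0 x1 (inner_integrand W (meval P) (fdop_act (meval Q) (darboux_N W Wt V))) \<and>
        winner x0 x1 Wt (meval (pdop_act P V)) (meval Q) =
        winner x0 x1 W (meval P) (fdop_act (meval Q) (darboux_N W Wt V)))"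

definition strong_darboux :: "ereal \<Rightarrow> ereal \<Rightarrow> 'n::finite fmat \<Rightarrow> 'n fmat \<Rightarrow> bool" where
  "strong_darboux x0 x1 W Wt \<longleftrightarrow> (\<exists>V. strong_darboux_transformer x0 x1 W Wt V)"


section \<open>The operators act as they should\<close>

lemma bounded_bilinear_cmat_mult: "bounded_bilinear ((**) :: complex^'n::finite^'n \<Rightarrow> complex^'n^'n \<Rightarrow> complex^'n^'n)"
proof -
  have "bilinear ((**) :: complex^'n::finite^'n \<Rightarrow> complex^'n^'n \<Rightarrow> complex^'n^'n)"
    unfolding bilinear_def
    by (auto intro!: linearI simp: matrix_matrix_mult_def vec_eq_iff scaleR_sum_right sum.distrib algebra_simps)
  then show ?thesis by (simp add: bilinear_conv_bounded_bilinear)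
qed

interpretation mm: bounded_bilinear "(**) :: complex^'n::finite^'n \<Rightarrow> complex^'n^'n \<Rightarrow> complex^'n^'n"
  by (rule bounded_bilinear_cmat_mult)

lemma vderiv_cong_open:
  assumes "open U" "\<And>x. x \<in> U \<Longrightarrow> f x = g x" "x \<in> U"
  shows "(vderiv ^^ n) f x = (vderiv ^^ n) g x"
  using assms(3)
proof (induction n arbitrary: x)
  case 0 then show ?case using assms by simp
next
  case (Suc n)
  have "eventually (\<lambda>y. (vderiv ^^ n) f y = (vderiv ^^ n) g y) (nhds x)"
    using Suc assms(1) eventually_nhds by blast
  then have "vderiv ((vderiv ^^ n) f) x = vderiv ((vderiv ^^ n) g) x"
    unfolding vderiv_def by (intro vector_derivative_cong_eq) auto
  then show ?case by simp
qed

lemma smooth_onD: "smooth_on U f \<Longrightarrow> x \<in> U \<Longrightarrow>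
   ((vderiv ^^ n) f has_vector_derivative (vderiv ^^ Suc n) f x) (at x)"
  by (simp add: smooth_on_def vderiv_def vector_derivative_works)

lemma smooth_onI:
  assumes "\<And>x. x \<in> U \<Longrightarrow> g 0 x = f x" "open U"
   "\<And>n x. x \<in> U \<Longrightarrow> (g n has_vector_derivative g (Suc n) x) (at x)"
  shows "smooth_on U f \<and> (\<forall>n. \<forall>x\<in>U. (vderiv ^^ n) f x = g n x)"
proof -
  have eq: "(vderiv ^^ n) f x = g n x" if "x \<in> U" for n x
    using that
  proof (induction n arbitrary: x)
    case 0 then show ?case using assms(1) by simp
  next
    case (Suc n)
    have "((vderiv ^^ n) f has_vector_derivative g (Suc n) x) (at x)"
      using assms(3)[OF Suc.prems, of n] 
      by (rule has_vector_derivative_transform_within_open[OF _ assms(2) Suc.prems]) (use Suc.IH in auto)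
    then show ?case by (auto simp: vderiv_def[of "(vderiv ^^ n) f"] intro: vector_derivative_at)
  qed
  have "(vderiv ^^ n) f differentiable (at x)" if "x \<in> U" for n x
    using assms(3)[OF that, of n] 
      has_vector_derivative_transform_within_open[of "g n" _ x U "(vderiv^^n) f"] that eq assms(2)
    by (metis differentiableI_vector)
  then show ?thesis using eq by (auto simp: smooth_on_def)
qed

lemma vderiv_leibniz_step:
  fixes a b :: "nat \<Rightarrow> 'n::finite cmat"
  shows "(\<Sum>k\<le>n. real (n choose k) *\<^sub>R (a k ** b (Suc (n - k)) + a (Suc k) ** b (n - k)))
    = (\<Sum>k\<le>Suc n. real (Suc n choose k) *\<^sub>R (a k ** b (Suc n - k)))"
proof -
  have *: "(\<Sum>k\<le>n. real (n choose k) *\<^sub>R (a k ** b (Suc (n - k)))) = 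
     a 0 ** b (Suc n) + (\<Sum>k\<le>n. real (n choose Suc k) *\<^sub>R (a (Suc k) ** b (n - k)))"
  proof -
    have "(\<Sum>k\<le>n. real (n choose k) *\<^sub>R (a k ** b (Suc (n - k)))) = (\<Sum>k\<le>n. real (n choose k) *\<^sub>R (a k ** b (Suc n - k)))"
      by (intro sum.cong) (auto simp: Suc_diff_le)
    also have "\<dots> = (\<Sum>k\<le>Suc n. real (n choose k) *\<^sub>R (a k ** b (Suc n - k)))"
      by simp
    also have "\<dots> = a 0 ** b (Suc n) + (\<Sum>k\<le>n. real (n choose Suc k) *\<^sub>R (a (Suc k) ** b (n - k)))"
      by (subst sum.atMost_Suc_shift) simp
    finally show ?thesis .
  qed
  have "(\<Sum>k\<le>Suc n. real (Suc n choose k) *\<^sub>R (a k ** b (Suc n - k))) = 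
     a 0 ** b (Suc n) + (\<Sum>k\<le>n. real ((n choose k) + (n choose Suc k)) *\<^sub>R (a (Suc k) ** b (n - k)))"
    by (subst sum.atMost_Suc_shift) (simp del: of_nat_add)
  also have "\<dots> = a 0 ** b (Suc n) + (\<Sum>k\<le>n. real (n choose Suc k) *\<^sub>R (a (Suc k) ** b (n - k)))
      + (\<Sum>k\<le>n. real (n choose k) *\<^sub>R (a (Suc k) ** b (n - k)))"
    by (simp only: of_nat_add scaleR_add_left sum.distrib add_ac)
  finally show ?thesis
    unfolding *[symmetric] by (simp only: scaleR_add_right sum.distrib)
qed

lemma vderiv_leibniz:
  fixes f g :: "'n::finite fmat"
  assumes "open U" "smooth_on U f" "smooth_on U g"
  shows "smooth_on U (\<lambda>x. f x ** g x) \<and> (\<forall>n. \<forall>x\<in>U. (vderiv ^^ n) (\<lambda>x. f x ** g x) x =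
    (\<Sum>k\<le>n. real (n choose k) *\<^sub>R ((vderiv ^^ k) f x ** (vderiv ^^ (n - k)) g x)))"
  using assms(1)
proof (intro smooth_onI)
  fix n x assume x: "x \<in> U"
  show "((\<lambda>x. \<Sum>k\<le>n. real (n choose k) *\<^sub>R ((vderiv ^^ k) f x ** (vderiv ^^ (n - k)) g x)) has_vector_derivative
     (\<Sum>k\<le>Suc n. real (Suc n choose k) *\<^sub>R ((vderiv ^^ k) f x ** (vderiv ^^ (Suc n - k)) g x))) (at x)"
    unfolding vderiv_leibniz_step[of n "\<lambda>k. (vderiv ^^ k) f x" "\<lambda>k. (vderiv ^^ k) g x", symmetric]
    by (intro has_vector_derivative_sum bounded_linear.has_vector_derivative[OF bounded_linear_scaleR_right]
        mm.has_vector_derivative smooth_onD[OF assms(2) x] smooth_onD[OF assms(3) x])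
qed auto

lemma smooth_sum:
  fixes f :: "'i \<Rightarrow> real \<Rightarrow> 'a::real_normed_vector"
  assumes "open U" "\<And>i. i \<in> I \<Longrightarrow> smooth_on U (f i)"
  shows "smooth_on U (\<lambda>x. \<Sum>i\<in>I. f i x) \<and> (\<forall>n. \<forall>x\<in>U. (vderiv ^^ n) (\<lambda>x. \<Sum>i\<in>I. f i x) x =
    (\<Sum>i\<in>I. (vderiv ^^ n) (f i) x))"
  using assms(1)
  by (intro smooth_onI) (auto intro!: has_vector_derivative_sum smooth_onD[OF assms(2)] simp del: funpow.simps)

lemma smooth_vderiv: "smooth_on U f \<Longrightarrow> smooth_on U ((vderiv ^^ i) f)"
  unfolding smooth_on_def by (metis comp_apply funpow_add)

lemma sum_apply: "(\<Sum>i\<in>I. f i) x = (\<Sum>i\<in>I. f i x)"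
  by (induction I rule: infinite_finite_induct) auto

lemma fdop_act_bound:
  assumes "degree D \<le> m"
  shows "fdop_act f D x = (\<Sum>i\<le>m. (vderiv ^^ i) f x ** coeff D i x)"
  unfolding fdop_act_def using assms
  by (intro sum.mono_neutral_left) (auto simp: coeff_eq_0)

lemma fdop_act_sum:
  assumes "finite I"
  shows "fdop_act f (\<Sum>i\<in>I. D i) x = (\<Sum>i\<in>I. fdop_act f (D i) x)"
proof -
  define m where "m = Max (insert (degree (\<Sum>i\<in>I. D i)) ((\<lambda>i. degree (D i)) ` I))"
  have "degree (\<Sum>i\<in>I. D i) \<le> m" "\<And>i. i \<in> I \<Longrightarrow> degree (D i) \<le> m"
    using assms unfolding m_def by auto
  then show ?thesis
    by (simp add: fdop_act_bound[of _ m] coeff_sum sum_apply mm.sum_right sum.swap[of _ I])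
qed

lemma fdop_act_monom: "fdop_act f (monom F i) x = (vderiv ^^ i) f x ** F x"
  by (subst fdop_act_bound[OF degree_monom_le]) (auto simp: if_distrib if_distribR cong: if_cong)

lemma fdop_act_dmult:
  fixes f :: "'n::finite fmat"
  assumes "open U" "smooth_on U f" "\<And>i. smooth_on U (coeff D i)" "x \<in> U"
  shows "fdop_act f (D \<odot> E) x = fdop_act (fdop_act f D) E x"
proof -
  have D: "(vderiv ^^ j) (fdop_act f D) x = (\<Sum>i\<le>degree D. \<Sum>k\<le>j. real (j choose k) *\<^sub>R 
      ((vderiv ^^ (i + k)) f x ** (vderiv ^^ (j - k)) (coeff D i) x))" for j
  proof -
    have "smooth_on U (\<lambda>x. (vderiv ^^ i) f x ** coeff D i x)" for i
      using vderiv_leibniz[OF assms(1) smooth_vderiv[OF assms(2)] assms(3)] by blast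
    then have "(vderiv ^^ j) (fdop_act f D) x = (\<Sum>i\<le>degree D. (vderiv ^^ j) (\<lambda>x. (vderiv ^^ i) f x ** coeff D i x) x)"
      unfolding fdop_act_def using smooth_sum[OF assms(1), of "{..degree D}" "\<lambda>i x. (vderiv ^^ i) f x ** coeff D i x"] assms(4) by blast
    also have "\<dots> = (\<Sum>i\<le>degree D. \<Sum>k\<le>j. real (j choose k) *\<^sub>R 
      ((vderiv ^^ k) ((vderiv ^^ i) f) x ** (vderiv ^^ (j - k)) (coeff D i) x))"
      using vderiv_leibniz[OF assms(1) smooth_vderiv[OF assms(2)] assms(3)] assms(4) by (intro sum.cong) auto
    moreover have "(vderiv ^^ k) ((vderiv ^^ i) f) = (vderiv ^^ (i + k)) f" for i k
      by (metis add.commute comp_apply funpow_add)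
    ultimately show ?thesis by simp
  qed
  have "fdop_act f (D \<odot> E) x = (\<Sum>i\<le>degree D. \<Sum>j\<le>degree E. \<Sum>k\<le>j. real (j choose k) *\<^sub>R
      ((vderiv ^^ (i + k)) f x ** ((vderiv ^^ (j - k)) (coeff D i) x ** coeff E j x)))"
    by (simp add: dmult_def fdop_act_sum fdop_act_monom mm.scaleR_right)
  also have "\<dots> = (\<Sum>j\<le>degree E. (vderiv ^^ j) (fdop_act f D) x ** coeff E j x)"
    unfolding D by (subst sum.swap) (simp add: mm.sum_left mm.scaleR_left matrix_mul_assoc)
  finally show ?thesis by (simp add: fdop_act_def)
qed

lemma fdop_act_dmult_mulop: "fdop_act f (D \<odot> mulop F) x = fdop_act f D x ** F x"
proof -
  have *: "D \<odot> mulop F = (\<Sum>i\<le>degree D. monom (\<lambda>x. coeff D i x ** F x) i)"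
    by (cases "F = 0") (auto simp: dmult_def mulop_def degree_monom_eq simp flip: zero_fun_def)
  show ?thesis unfolding * by (subst fdop_act_sum) (simp_all add: fdop_act_monom fdop_act_def[of f D] mm.sum_left matrix_mul_assoc)
qed

lemma smooth_on_const: "smooth_on U (\<lambda>x. c)"
proof -
  have "(vderiv ^^ n) (\<lambda>x. c) = (\<lambda>x. if n = 0 then c else 0)" for n
    by (induction n) (auto simp: vderiv_def)
  then show ?thesis by (simp add: smooth_on_def)
qed

lemma has_vector_derivative_vec:
  fixes f :: "real \<Rightarrow> 'a::real_normed_vector^'n::finite"
  assumes "\<And>i. ((\<lambda>x. f x $ i) has_vector_derivative f' $ i) (at x)"
  shows "(f has_vector_derivative f') (at x)"
proof -
  have "((\<lambda>y. ((f y - f x) - (y - x) *\<^sub>R f') /\<^sub>R norm (y - x)) \<longlongrightarrow> 0) (at x)"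
    using assms by (intro vec_tendstoI) (simp add: has_vector_derivative_def has_derivative_within divide_inverse diff_diff_eq)
  then show ?thesis 
    by (simp add: has_vector_derivative_def has_derivative_within bounded_linear_scaleR_left divide_inverse diff_diff_eq)
qed

lemma meval_deriv: "(meval P has_vector_derivative meval (mpderiv P) x) (at x)"
proof -
  have "((\<lambda>x. poly p (complex_of_real x)) has_vector_derivative poly (pderiv p) (complex_of_real x)) (at x)" for p
    by (rule has_vector_derivative_real_field) (simp add: poly_DERIV)
  then show ?thesis
    unfolding meval_def[abs_def] mpderiv_def map_matrix_def
    by (intro has_vector_derivative_vec) simp
qed

lemma smooth_meval: "smooth_on UNIV (meval P) \<and> (\<forall>n. \<forall>x\<in>UNIV. (vderiv ^^ n) (meval P) x = meval ((mpderiv ^^ n) P) x)"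
  by (intro smooth_onI) (auto intro: meval_deriv)

lemma meval_mult: "meval (P ** Q) x = meval P x ** meval Q x"
  by (simp add: meval_def map_matrix_def matrix_matrix_mult_def vec_eq_iff poly_sum)
lemma meval_sum: "meval (\<Sum>i\<in>I. P i) x = (\<Sum>i\<in>I. meval (P i) x)"
  by (simp add: meval_def map_matrix_def vec_eq_iff poly_sum)
lemma meval_0: "meval 0 = 0"
  by (auto simp: meval_def map_matrix_def vec_eq_iff)
lemma coeff_fdop: "coeff (fdop D) i = meval (coeff D i)"
  by (simp add: fdop_def coeff_map_poly meval_0)

lemma meval_pdop_act: "meval (pdop_act P D) = fdop_act (meval P) (fdop D)"
proof
  fix x
  have "degree (fdop D) \<le> degree D" unfolding fdop_def by (rule map_poly_degree_leq)
  then show "meval (pdop_act P D) x = fdop_act (meval P) (fdop D) x" using smooth_meval[of P]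
    by (simp add: fdop_act_bound pdop_act_def meval_sum meval_mult coeff_fdop)
qed

lemma has_vector_derivative_hadj:
  assumes "(f has_vector_derivative f') (at x)"
  shows "((\<lambda>x. hadj (f x)) has_vector_derivative hadj f') (at x)"
proof -
  have "linear hadj"
    by (auto intro!: linearI simp: hadj_def map_matrix_def transpose_def vec_eq_iff)
  then show ?thesis
    using assms bounded_linear.has_vector_derivative linear_conv_bounded_linear by blast
qed

lemma smooth_hadj: "open U \<Longrightarrow> smooth_on U f \<Longrightarrow> smooth_on U (\<lambda>x. hadj (f x))"
  using smooth_onI[of U "\<lambda>n x. hadj ((vderiv ^^ n) f x)" "\<lambda>x. hadj (f x)"] 
  by (metis funpow_0 has_vector_derivative_hadj smooth_onD)

lemma smooth_coeff_mulop: "smooth_on U F \<Longrightarrow> smooth_on U (coeff (mulop F) i)"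
  using smooth_on_const[of U 0] by (auto simp: mulop_def zero_fun_def)

lemma fdop_act_darboux_N:
  fixes f W Wt :: "'n::finite fmat"
  assumes "open U" "smooth_on U f" "smooth_on U Wt" "x \<in> U"
  shows "fdop_act f (darboux_N W Wt V) x =
    (\<Sum>j\<le>degree V. (-1) ^ j *\<^sub>R (vderiv ^^ j) (\<lambda>x. f x ** Wt x ** hadj (meval (coeff V j) x)) x)
      ** matrix_inv (W x)"
proof -
  have g: "smooth_on U (\<lambda>x. f x ** Wt x)" using vderiv_leibniz assms by blast
  have mul: "fdop_act f (mulop F) = (\<lambda>x. f x ** F x)" for F and f :: "'n fmat"
    by (auto simp: mulop_def fdop_act_monom)
  have h: "smooth_on U (\<lambda>x. hadj (meval (coeff V j) x))" for j
    using smooth_meval[of "coeff V j"] by (intro smooth_hadj assms) (auto simp: smooth_on_def)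
  have "fdop_act f (mulop Wt \<odot> formal_adjoint (fdop V)) x = fdop_act (\<lambda>x. f x ** Wt x) (formal_adjoint (fdop V)) x"
    using assms by (simp add: fdop_act_dmult[OF assms(1,2) smooth_coeff_mulop] mul)
  also have "\<dots> = (\<Sum>j\<le>degree (fdop V). (-1) ^ j *\<^sub>R (vderiv ^^ j) (\<lambda>x. f x ** Wt x ** hadj (meval (coeff V j) x)) x)"
    unfolding formal_adjoint_def coeff_fdop
    by (simp add: fdop_act_sum fdop_act_dmult[OF assms(1) g smooth_coeff_mulop[OF h] assms(4)] mul fdop_act_monom mm.scaleR_right)
  also have "\<dots> = (\<Sum>j\<le>degree V. (-1) ^ j *\<^sub>R (vderiv ^^ j) (\<lambda>x. f x ** Wt x ** hadj (meval (coeff V j) x)) x)"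
  proof (intro sum.mono_neutral_left ballI)
    show "{..degree (fdop V)} \<subseteq> {..degree V}" unfolding fdop_def by (simp add: map_poly_degree_leq)
    fix j assume "j \<in> {..degree V} - {..degree (fdop V)}"
    then have "meval (coeff V j) = 0" by (metis DiffD2 atMost_iff coeff_eq_0 coeff_fdop leI)
    moreover have "f x ** Wt x ** hadj 0 = 0" for x
      by (simp add: hadj_def map_matrix_def transpose_def matrix_matrix_mult_def vec_eq_iff)
    moreover have "(vderiv ^^ j) (\<lambda>x. 0 :: 'n cmat) = (\<lambda>x. 0)"
      by (induction j) (auto simp: vderiv_def)
    ultimately show "(-1) ^ j *\<^sub>R (vderiv ^^ j) (\<lambda>x. f x ** Wt x ** hadj (meval (coeff V j) x)) x = 0" by simp
  qed simp
  finally show ?thesis by (simp add: darboux_N_def fdop_act_dmult_mulop)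
qed

end

theory Submission
  imports Defs
begin

text \<open>The leading coefficients of \<open>x\<^sup>n I \<cdot> V\<close> are invertible because \<open>V\<close> preserves degrees, so every
  matrix polynomial of degree at most \<open>n\<close> is some \<open>P \<cdot> V\<close> with \<open>deg P \<le> n\<close>. As
  \<open>(P \<cdot> V) \<cdot> N = P \<cdot> D\<close>, the operator \<open>N\<close> maps polynomials to polynomials without raising degrees, and an
  operator with this property has polynomial coefficients. Hence \<open>V S N\<close> is an operator \<open>E\<close> with
  polynomial coefficients that does not raise degrees, and
  \<open>\<langle>P \<cdot> E, Q\<rangle>\<^sub>W = \<langle>(P \<cdot> V) \<cdot> S, Q \<cdot> V\<rangle> = \<langle>P \<cdot> V, (Q \<cdot> V) \<cdot> S\<rangle> = \<langle>P, Q \<cdot> E\<rangle>\<^sub>W\<close>, the middle products being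
  those of the weight \<open>Wt\<close>. Finally, a symmetric operator that does not raise degrees has the
  orthogonal polynomials as eigenfunctions: if \<open>R = P\<^sub>n \<cdot> E - \<Lambda> P\<^sub>n\<close> has degree less than \<open>n\<close>, then
  \<open>\<langle>R, R\<rangle> = \<langle>P\<^sub>n, R \<cdot> E\<rangle> - \<Lambda> \<langle>P\<^sub>n, R\<rangle> = 0\<close>.\<close>

section \<open>Matrix polynomials and their degrees\<close>

definition mmonom :: "'n::finite cmat \<Rightarrow> nat \<Rightarrow> 'n pmat" where
  "mmonom A k = map_matrix (\<lambda>c. monom c k) A"

lemma mmonom_eq_0_iff: "mmonom A k = 0 \<longleftrightarrow> A = 0"
  by (simp add: mmonom_def vec_eq_iff)

lemma mconst_0: "mconst 0 = 0"
  by (simp add: mconst_def vec_eq_iff)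

lemma mcoeff_add: "mcoeff (P + Q) k = mcoeff P k + mcoeff Q k"
  by (simp add: mcoeff_def vec_eq_iff)

lemma mcoeff_diff: "mcoeff (P - Q) k = mcoeff P k - mcoeff Q k"
  by (simp add: mcoeff_def vec_eq_iff)

lemma mcoeff_mconst_mult: "mcoeff (mconst A ** P) k = A ** mcoeff P k"
  by (simp add: mcoeff_def mconst_def vec_eq_iff matrix_matrix_mult_def coeff_sum)

lemma mcoeff_mmonom: "mcoeff (mmonom A k) m = (if m = k then A else 0)"
  by (auto simp: mcoeff_def mmonom_def vec_eq_iff)

lemma pmat_eq_iff: "P = Q \<longleftrightarrow> (\<forall>k. mcoeff P k = mcoeff Q k)"
  by (auto simp: mcoeff_def vec_eq_iff poly_eq_iff)

lemma mdegree_le_iff_entries: "mdegree P \<le> n \<longleftrightarrow> (\<forall>i j. degree (P $ i $ j) \<le> n)"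
  by (auto simp: mdegree_def)

lemma mdegree_le_iff: "mdegree P \<le> n \<longleftrightarrow> (\<forall>k>n. mcoeff P k = 0)"
proof -
  have "degree p \<le> n \<longleftrightarrow> (\<forall>k>n. coeff p k = 0)" for p :: "complex poly"
    using coeff_eq_0[of p] degree_le[of n p] by fastforce
  then show ?thesis
    by (auto simp: mdegree_le_iff_entries mcoeff_def vec_eq_iff)
qed

lemma mcoeff_eq_0: "mdegree P < k \<Longrightarrow> mcoeff P k = 0"
  using mdegree_le_iff by blast

lemma mdegree_add_le: "mdegree P \<le> n \<Longrightarrow> mdegree Q \<le> n \<Longrightarrow> mdegree (P + Q) \<le> n"
  by (simp add: mdegree_le_iff mcoeff_add)

lemma mdegree_mconst_mult_le: "mdegree P \<le> n \<Longrightarrow> mdegree (mconst A ** P) \<le> n"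
  by (simp add: mdegree_le_iff mcoeff_mconst_mult)

lemma mdegree_sum_le:
  "(\<And>k. k \<in> I \<Longrightarrow> mdegree (P k) \<le> n) \<Longrightarrow> mdegree (\<Sum>k\<in>I. P k) \<le> n"
proof (induction I rule: infinite_finite_induct)
  case (insert x F)
  then show ?case by (simp add: mdegree_add_le)
qed (auto simp: mdegree_le_iff mcoeff_def vec_eq_iff)

lemma mdegree_mmonom_le: "mdegree (mmonom A k) \<le> k"
  by (simp add: mdegree_le_iff mcoeff_mmonom)

lemma mdegree_mmonom:
  assumes "A \<noteq> 0"
  shows "mdegree (mmonom A k) = k"
proof (rule antisym[OF mdegree_mmonom_le])
  show "k \<le> mdegree (mmonom A k)"
    using assms mcoeff_eq_0[of "mmonom A k" k] by (metis mcoeff_mmonom not_le)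
qed

lemma mconst_mult_mmonom: "mconst A ** mmonom B k = mmonom (A ** B) k"
  by (simp add: pmat_eq_iff mcoeff_mconst_mult mcoeff_mmonom)

text \<open>The alternative \<open>P = 0\<close> is forced by the convention
  \<open>mdegree 0 = 0\<close>: for \<open>n = 0\<close> there is no smaller degree.\<close>

lemma pmat_eq_0_or_mdegree_less:
  assumes "mdegree P \<le> n" "mcoeff P n = 0"
  shows "P = 0 \<or> mdegree P < n"
proof -
  have *: "mcoeff P k = 0" if "k \<ge> n" for k
    using that assms mcoeff_eq_0[of P k] by (cases "k = n") auto
  show ?thesis
  proof (cases n)
    case 0
    with * have "P = 0"
      by (simp add: pmat_eq_iff) (simp add: mcoeff_def vec_eq_iff)
    then show ?thesis ..
  next
    case (Suc m)
    with * have "mdegree P \<le> m"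
      by (simp add: mdegree_le_iff)
    then show ?thesis using Suc by simp
  qed
qed

text \<open>Subtracting \<open>mcoeff Q n\<close> times \<open>P n\<close> removes the top
  coefficient, and induction on the degree bound treats the rest. The coefficients stand on the
  left, where operators acting on the right leave them untouched.\<close>

lemma monic_sequence_expansion:
  assumes "\<And>n. mdegree (P n) \<le> n" "\<And>n. mcoeff (P n) n = mat 1"
    and "mdegree Q \<le> n"
  shows "\<exists>C. Q = (\<Sum>k\<le>n. mconst (C k) ** P k)"
  using assms(3)
proof (induction n arbitrary: Q rule: less_induct)
  case (less n)
  define R where "R = Q - mconst (mcoeff Q n) ** P n"
  have "mcoeff R k = 0" if "k \<ge> n" for k
  proof (cases "k = n")
    case True
    then show ?thesis
      by (simp add: R_def mcoeff_diff mcoeff_mconst_mult assms(2))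
  next
    case False
    with that assms(1)[of n] less.prems have "mdegree (P n) < k" "mdegree Q < k"
      by linarith+
    then show ?thesis
      by (simp add: R_def mcoeff_diff mcoeff_mconst_mult mcoeff_eq_0)
  qed
  then have "R = 0 \<or> mdegree R < n"
    by (intro pmat_eq_0_or_mdegree_less) (auto simp: mdegree_le_iff)
  then obtain C where C: "R = (\<Sum>k<n. mconst (C k) ** P k)"
  proof
    assume "R = 0"
    then show ?thesis using that[of "\<lambda>_. 0"] by (simp add: mconst_0)
  next
    assume *: "mdegree R < n"
    then obtain m where m: "n = Suc m" by (cases n) auto
    with * obtain C where "R = (\<Sum>k\<le>m. mconst (C k) ** P k)"
      using less.IH[of m R] by auto
    then show ?thesis using that m lessThan_Suc_atMost by metis
  qed
  define C' where "C' = C(n := mcoeff Q n)"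
  have "(\<Sum>k<n. mconst (C' k) ** P k) = R"
    unfolding C by (intro sum.cong) (auto simp: C'_def)
  then have "Q = (\<Sum>k\<le>n. mconst (C' k) ** P k)"
    by (simp add: R_def C'_def flip: lessThan_Suc_atMost)
  then show ?case by blast
qed


section \<open>Operators on matrix polynomials\<close>

lemma matrix_add_rdistrib:
  fixes A B C :: "'a::semiring_1^'n^'n"
  shows "(A + B) ** C = A ** C + B ** C"
  by (simp add: vec_eq_iff matrix_matrix_mult_def distrib_right sum.distrib)

lemma matrix_mult_sum_right:
  fixes B :: "'a::semiring_1^'n^'n" and A :: "'i \<Rightarrow> 'a^'n^'n"
  shows "B ** (\<Sum>i\<in>I. A i) = (\<Sum>i\<in>I. B ** A i)"
  by (induction I rule: infinite_finite_induct) (auto simp: matrix_add_ldistrib)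

lemma mpderiv_pow_entry: "(mpderiv ^^ i) P $ a $ b = (pderiv ^^ i) (P $ a $ b)"
  by (induction i arbitrary: a b) (auto simp: mpderiv_def)

lemma mpderiv_pow_0: "(mpderiv ^^ i) 0 = 0"
  by (induction i) (auto simp: mpderiv_def vec_eq_iff)

lemma mpderiv_pow_add: "(mpderiv ^^ i) (P + Q) = (mpderiv ^^ i) P + (mpderiv ^^ i) Q"
  by (induction i) (auto simp: mpderiv_def vec_eq_iff pderiv_add)

lemma mpderiv_pow_mconst_mult: "(mpderiv ^^ i) (mconst A ** P) = mconst A ** (mpderiv ^^ i) P"
proof (induction i)
  case (Suc i)
  have "mpderiv (mconst A ** Q) = mconst A ** mpderiv Q" for Q
    by (simp add: mpderiv_def mconst_def vec_eq_iff matrix_matrix_mult_def higher_pderiv_sum[of 1, simplified] pderiv_smult)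
  with Suc show ?case by simp
qed simp

lemma pdop_act_add: "pdop_act (P + Q) D = pdop_act P D + pdop_act Q D"
  by (simp add: pdop_act_def mpderiv_pow_add matrix_add_rdistrib sum.distrib)

lemma pdop_act_0: "pdop_act 0 D = 0"
  by (simp add: pdop_act_def mpderiv_pow_0)

lemma pdop_act_mconst_mult: "pdop_act (mconst A ** P) D = mconst A ** pdop_act P D"
  by (simp add: pdop_act_def mpderiv_pow_mconst_mult matrix_mult_sum_right matrix_mul_assoc)

lemma pdop_act_sum: "pdop_act (\<Sum>k\<in>I. P k) D = (\<Sum>k\<in>I. pdop_act (P k) D)"
  by (induction I rule: infinite_finite_induct) (auto simp: pdop_act_0 pdop_act_add)

text \<open>In the expansion of \<open>Q\<close> in \<open>P 0, ..., P n\<close> the operator only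
  changes the left coefficients, from \<open>C k\<close> to
  \<open>C k ** \<Lambda> k\<close>.\<close>

lemma eigenoperator_mdegree_le:
  assumes "\<And>n. mdegree (P n) \<le> n" "\<And>n. mcoeff (P n) n = mat 1"
    and "\<And>n. \<exists>\<Lambda>. pdop_act (P n) D = mconst \<Lambda> ** P n"
    and "mdegree Q \<le> n"
  shows "mdegree (pdop_act Q D) \<le> n"
proof -
  obtain C where C: "Q = (\<Sum>k\<le>n. mconst (C k) ** P k)"
    using monic_sequence_expansion assms(1,2,4) by blast
  obtain \<Lambda> where \<Lambda>: "\<And>k. pdop_act (P k) D = mconst (\<Lambda> k) ** P k"
    using assms(3) by metis
  have "mdegree (P k) \<le> n" if "k \<le> n" for k
    using assms(1)[of k] that by linarith
  then show ?thesis
    unfolding C pdop_act_sum by (auto intro!: mdegree_sum_le mdegree_mconst_mult_le simp: pdop_act_mconst_mult \<Lambda>)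
qed

lemma alg_D_mdegree_le:
  assumes "D \<in> alg_D x0 x1 W" "mdegree Q \<le> n"
  shows "mdegree (pdop_act Q D) \<le> n"
proof -
  from assms obtain P where "monic_orthogonal x0 x1 W P"
    "\<And>n. \<exists>\<Lambda>. pdop_act (P n) D = mconst \<Lambda> ** P n"
    unfolding alg_D_def by blast
  then show ?thesis
    using assms(2) by (intro eigenoperator_mdegree_le[of P]) (auto simp: monic_orthogonal_def)
qed

text \<open>The leading coefficients \<open>A\<^sub>n\<close> of \<open>x\<^sup>n I \<cdot> V\<close> are invertible: a row vector killed by \<open>A\<^sub>n\<close> would
  give a matrix polynomial of degree \<open>n\<close> whose degree drops.\<close>

lemma degree_preserving_surj:
  fixes V :: "'n::finite pdop"
  assumes "degree_preserving V" "mdegree Q \<le> n"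
  shows "\<exists>P. mdegree P \<le> n \<and> pdop_act P V = Q"
proof -
  have deg: "mdegree (pdop_act P V) = mdegree P" and zero: "pdop_act P V = 0 \<longleftrightarrow> P = 0" for P
    using assms(1) by (auto simp: degree_preserving_def)
  define X where "X = (mmonom (mat 1 :: 'n cmat))"
  define A where "A k = mcoeff (pdop_act (X k) V) k" for k
  have X: "mdegree (X k) \<le> k" for k
    by (simp add: X_def mdegree_mmonom_le)
  have inv: "invertible (A k)" for k
  proof (rule ccontr)
    assume "\<not> invertible (A k)"
    then have "\<not> invertible (transpose (A k))"
      by (simp add: invertible_det_nz)
    then obtain v where v: "transpose (A k) *v v = 0" "v \<noteq> 0"
      unfolding invertible_left_inverse matrix_left_invertible_ker by blast
    \<comment> \<open>All rows of \<open>C\<close> equal \<open>v\<close>, so every row of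
      \<open>C ** A k\<close> is the zero vector \<open>transpose (A k) *v v\<close>.\<close>
    define C :: "'n cmat" where "C = (\<chi> i j. v $ j)"
    from v(2) have C: "C \<noteq> 0"
      by (auto simp: C_def vec_eq_iff)
    have "(C ** A k) $ i $ j = (transpose (A k) *v v) $ j" for i j
      by (simp add: C_def matrix_matrix_mult_def matrix_vector_mult_def transpose_def mult.commute)
    with v(1) have CA: "C ** A k = 0"
      by (simp add: vec_eq_iff)
    define Y where "Y = mconst C ** X k"
    have Y: "Y = mmonom C k"
      by (simp add: Y_def X_def mconst_mult_mmonom)
    have "mcoeff (pdop_act Y V) k = 0"
      using CA by (simp add: Y_def pdop_act_mconst_mult mcoeff_mconst_mult A_def)
    moreover have "mdegree (pdop_act Y V) = k"
      using C by (simp add: deg Y mdegree_mmonom)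
    ultimately have "pdop_act Y V = 0"
      using pmat_eq_0_or_mdegree_less[of "pdop_act Y V" k] by auto
    then show False
      using C by (simp add: zero Y mmonom_eq_0_iff)
  qed
  from inv obtain B where BA: "B k ** A k = mat 1" for k
    unfolding invertible_left_inverse by metis
  \<comment> \<open>The polynomials \<open>mconst (B k) ** pdop_act (X k) V\<close> are monic of
    degree \<open>k\<close>. Expanding \<open>Q\<close> in them and replacing each image by
    \<open>X k\<close> gives a preimage.\<close>
  have "\<exists>C. Q = (\<Sum>k\<le>n. mconst (C k) ** (mconst (B k) ** pdop_act (X k) V))"
    using assms(2) X BA
    by (intro monic_sequence_expansion mdegree_mconst_mult_le)
      (auto simp: deg mcoeff_mconst_mult simp flip: A_def)
  then obtain C where C: "Q = (\<Sum>k\<le>n. mconst (C k) ** (mconst (B k) ** pdop_act (X k) V))" ..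
  define P where "P = (\<Sum>k\<le>n. mconst (C k) ** (mconst (B k) ** X k))"
  have "pdop_act P V = Q"
    by (simp add: C P_def pdop_act_sum pdop_act_mconst_mult)
  moreover have "mdegree (X k) \<le> n" if "k \<le> n" for k
    using X[of k] that by linarith
  then have "mdegree P \<le> n"
    unfolding P_def by (intro mdegree_sum_le mdegree_mconst_mult_le) auto
  ultimately show ?thesis by blast
qed


section \<open>Operators mapping polynomials to polynomials\<close>

text \<open>Differentiation only shifts the index of the divided powers
  \<open>x\<^sup>k / k!\<close>, without numerical factors.\<close>

lemma higher_pderiv_monom_fact:
  "(pderiv ^^ i) (monom (1 / fact k :: complex) k) =
     (if k < i then 0 else monom (1 / fact (k - i)) (k - i))"
proof -
  \<comment> \<open>The Pochhammer factor is \<open>(n + i)! / n!\<close>, which \<open>i\<close>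
    derivatives contribute to the coefficient arriving at index \<open>n\<close>.\<close>
  have "pochhammer (of_nat (Suc n)) i * (1 / fact (n + i)) = (1 / fact n :: complex)" for n
  proof -
    have "(fact (n + i) :: complex) = fact n * pochhammer (of_nat (Suc n)) i"
      using pochhammer_product'[of "1 :: complex" n i] by (simp add: flip: pochhammer_fact)
    moreover have "(fact (n + i) :: complex) \<noteq> 0" by simp
    ultimately show ?thesis by simp
  qed
  then show ?thesis
    by (auto simp: poly_eq_iff coeff_higher_pderiv coeff_monom)
qed

lemma mpderiv_pow_mmonom:
  "(mpderiv ^^ i) (mmonom (mat (1 / fact k)) k) =
     (if k < i then 0 else mmonom (mat (1 / fact (k - i))) (k - i))"
  by (auto simp: mmonom_def vec_eq_iff mat_def mpderiv_pow_entry higher_pderiv_monom_fact)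

text \<open>Testing on \<open>x\<^sup>k I / k!\<close> yields \<open>coeff L k\<close> up to terms with lower coefficients.\<close>

lemma fdop_polynomial_coeffs:
  fixes L :: "'n::finite fdop"
  assumes "\<And>Q. \<exists>R. \<forall>x\<in>U. fdop_act (meval Q) L x = meval R x"
  shows "\<exists>E. dop_eq_on U L (fdop E)"
proof -
  have "\<exists>C. \<forall>x\<in>U. coeff L k x = meval C x" for k
  proof (induction k rule: less_induct)
    case (less k)
    then obtain C where C: "\<And>i x. i < k \<Longrightarrow> x \<in> U \<Longrightarrow> coeff L i x = meval (C i) x"
      by metis
    define X :: "'n pmat" where "X = mmonom (mat (1 / fact k)) k"
    obtain R where R: "\<And>x. x \<in> U \<Longrightarrow> fdop_act (meval X) L x = meval R x"
      using assms by blast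
    define S where "S = (\<Sum>i<k. (mpderiv ^^ i) X ** C i)"
    have "coeff L k x = meval (R - S) x" if x: "x \<in> U" for x
    proof -
      \<comment> \<open>The maximum lets the sum reach index \<open>k\<close> even if
        \<open>L\<close> has smaller order.\<close>
      define m where "m = max k (degree L)"
      have "meval R x = (\<Sum>i\<le>m. meval ((mpderiv ^^ i) X) x ** coeff L i x)"
        using R[OF x] fdop_act_bound[of L m "meval X" x] smooth_meval[of X] by (simp add: m_def)
      \<comment> \<open>Derivatives of \<open>X\<close> of order above \<open>k\<close> vanish,
        which removes the coefficients of \<open>L\<close> not yet treated.\<close>
      also have "\<dots> = (\<Sum>i\<le>k. meval ((mpderiv ^^ i) X) x ** coeff L i x)"
        by (intro sum.mono_neutral_right) (auto simp: m_def X_def mpderiv_pow_mmonom meval_0)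
      also have "\<dots> = (\<Sum>i<k. meval ((mpderiv ^^ i) X) x ** coeff L i x)
          + meval ((mpderiv ^^ k) X) x ** coeff L k x"
        by (simp flip: lessThan_Suc_atMost)
      also have "(\<Sum>i<k. meval ((mpderiv ^^ i) X) x ** coeff L i x) = meval S x"
        using x by (simp add: S_def meval_sum meval_mult C)
      also have "meval ((mpderiv ^^ k) X) x = mat 1"
        by (simp add: X_def mpderiv_pow_mmonom) (simp add: meval_def mmonom_def vec_eq_iff mat_def)
      finally show ?thesis
        by (simp add: meval_def vec_eq_iff)
    qed
    then show ?case by blast
  qed
  then obtain C where C: "\<And>k x. x \<in> U \<Longrightarrow> coeff L k x = meval (C k) x"
    by metis
  \<comment> \<open>The discarded \<open>C k\<close> with \<open>k > degree L\<close> evaluate on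
    \<open>U\<close> to coefficients of \<open>L\<close> beyond its degree, hence to 0.\<close>
  define E where "E = (\<Sum>k\<le>degree L. monom (C k) k)"
  have "coeff E k = (if k \<le> degree L then C k else 0)" for k
    by (simp add: E_def coeff_sum)
  then have "dop_eq_on U L (fdop E)"
    by (auto simp: dop_eq_on_def coeff_fdop C[symmetric] meval_0 coeff_eq_0)
  then show ?thesis ..
qed

lemma fdop_act_dop_eq_on:
  assumes "dop_eq_on U D E" "x \<in> U"
  shows "fdop_act f D x = fdop_act f E x"
  using assms
  by (simp add: fdop_act_bound[of D "max (degree D) (degree E)"]
      fdop_act_bound[of E "max (degree D) (degree E)"] dop_eq_on_def)

lemma smooth_on_meval: "smooth_on U (meval P)"
  using smooth_meval[of P] by (auto simp: smooth_on_def)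

text \<open>The product differentiates only coefficients of its left factor, here polynomials. The
  right factor may have arbitrary functions as coefficients, as \<open>N\<close> does.\<close>

lemma fdop_act_fdop_dmult:
  assumes "open U" "x \<in> U"
  shows "fdop_act (meval Q) (fdop D \<odot> E) x = fdop_act (meval (pdop_act Q D)) E x"
  using assms fdop_act_dmult[of U "meval Q" "fdop D" x E]
  by (simp add: smooth_on_meval coeff_fdop meval_pdop_act)

text \<open>The operator \<open>T\<close> is read off from the action on polynomials. With
  \<open>UNIV\<close> as the test set the coefficients agree everywhere, so the operators are
  equal.\<close>

lemma fdop_dmult:
  "\<exists>T. fdop D \<odot> fdop E = fdop T \<and> (\<forall>P. meval (pdop_act P T) = meval (pdop_act (pdop_act P D) E))"
proof -
  have act: "fdop_act (meval Q) (fdop D \<odot> fdop E) x = meval (pdop_act (pdop_act Q D) E) x" for Q x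
    by (simp add: fdop_act_fdop_dmult[of UNIV] flip: meval_pdop_act)
  then obtain T where "dop_eq_on UNIV (fdop D \<odot> fdop E) (fdop T)"
    using fdop_polynomial_coeffs[of UNIV "fdop D \<odot> fdop E"] by metis
  then have "fdop D \<odot> fdop E = fdop T"
    by (auto simp: dop_eq_on_def poly_eq_iff)
  then show ?thesis
    using act by (intro exI[of _ T]) (auto simp: meval_pdop_act)
qed


section \<open>Inner products of matrix polynomials\<close>

lemma hadj_hadj: "hadj (hadj A) = A"
  by (simp add: hadj_def vec_eq_iff transpose_def)

lemma hadj_mult: "hadj (A ** B) = hadj B ** hadj A"
  by (simp add: hadj_def vec_eq_iff transpose_def matrix_matrix_mult_def mult.commute)

lemma bounded_linear_hadj: "bounded_linear hadj"
proof -
  have "linear hadj"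
    by (auto intro!: linearI simp: hadj_def transpose_def vec_eq_iff)
  then show ?thesis
    by (simp add: linear_conv_bounded_linear)
qed

lemma meval_add: "meval (P + Q) x = meval P x + meval Q x"
  by (simp add: meval_def vec_eq_iff)

lemma meval_diff: "meval (P - Q) x = meval P x - meval Q x"
  by (simp add: meval_def vec_eq_iff)

lemma meval_mconst: "meval (mconst A) x = A"
  by (simp add: meval_def mconst_def vec_eq_iff)

lemma meval_expand: "meval P x = (\<Sum>k\<le>mdegree P. x ^ k *\<^sub>R mcoeff P k)"
proof -
  have "poly (P $ i $ j) (complex_of_real x) =
      (\<Sum>k\<le>mdegree P. coeff (P $ i $ j) k * complex_of_real x ^ k)" for i j
    unfolding poly_altdef using mdegree_le_iff_entries[of P "mdegree P"]
    by (intro sum.mono_neutral_left) (auto simp: coeff_eq_0)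
  then show ?thesis
    by (simp add: vec_eq_iff meval_def mcoeff_def) (simp add: scaleR_conv_of_real mult.commute)
qed

text \<open>A nonzero entry has only finitely many roots. This lifts identities known only where
  \<open>W\<close> is invertible to identities of polynomials.\<close>

lemma pmat_eq_0_if_meval_infinite:
  assumes "infinite X" "\<And>x. x \<in> X \<Longrightarrow> meval P x = 0"
  shows "P = 0"
proof -
  have "P $ i $ j = 0" for i j
  proof (rule ccontr)
    assume "P $ i $ j \<noteq> 0"
    then have "finite {z. poly (P $ i $ j) z = 0}"
      by (rule poly_roots_finite)
    moreover have "complex_of_real ` X \<subseteq> {z. poly (P $ i $ j) z = 0}"
      using assms(2) by (auto simp: meval_def vec_eq_iff)
    ultimately show False
      using assms(1) finite_subset finite_imageD[of complex_of_real X] by (metis inj_of_real inj_on_subset subset_UNIV)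
  qed
  then show ?thesis by (simp add: vec_eq_iff)
qed

lemma pmat_eq_if_meval_infinite:
  assumes "infinite X" "\<And>x. x \<in> X \<Longrightarrow> meval P x = meval Q x"
  shows "P = Q"
  using pmat_eq_0_if_meval_infinite[of X "P - Q"] assms by (simp add: meval_diff)

lemma set_integrable_bounded_linear:
  assumes "bounded_linear T" "set_integrable M A f"
  shows "set_integrable M A (\<lambda>x. T (f x))"
  using integrable_bounded_linear[OF assms(1) assms(2)[unfolded set_integrable_def]]
  by (simp add: set_integrable_def linear_simps(5)[OF assms(1)])

lemma set_integral_bounded_linear:
  assumes "bounded_linear T" "set_integrable M A f"
  shows "(LINT x:A|M. T (f x)) = T (LINT x:A|M. f x)"
  using integral_bounded_linear[OF assms(1) assms(2)[unfolded set_integrable_def]]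
  by (simp add: set_lebesgue_integral_def linear_simps(5)[OF assms(1)])

lemma set_integrable_sum:
  assumes "\<And>i. i \<in> I \<Longrightarrow> set_integrable M A (f i)"
  shows "set_integrable M A (\<lambda>x. \<Sum>i\<in>I. f i x)"
  using assms unfolding set_integrable_def scaleR_sum_right by (rule Bochner_Integration.integrable_sum)

text \<open>The integrand is a finite sum of moment integrands
  \<open>x\<^sup>k\<^sup>+\<^sup>l W\<close> multiplied by constant matrices on both sides.\<close>

lemma mintegrable_inner_integrand:
  assumes "finite_moments x0 x1 W"
  shows "mintegrable x0 x1 (inner_integrand W (meval P) (meval Q))"
proof -
  have "inner_integrand W (meval P) (meval Q) = (\<lambda>x. \<Sum>k\<le>mdegree P. \<Sum>l\<le>mdegree Q.
      mcoeff P k ** (x ^ (k + l) *\<^sub>R W x) ** hadj (mcoeff Q l))"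
    unfolding inner_integrand_def meval_expand
    by (simp add: linear_simps[OF bounded_linear_hadj] linear_sum[OF bounded_linear.linear[OF bounded_linear_hadj]]
        mm.sum_left mm.sum_right mm.scaleR_left mm.scaleR_right power_add ac_simps scaleR_sum_right
        sum.swap[of _ "{..mdegree Q}"])
  moreover have "bounded_linear (\<lambda>X. A ** X ** B)" for A B :: "'a cmat"
    by (rule bounded_linear_compose[OF mm.bounded_linear_left mm.bounded_linear_right])
  ultimately show ?thesis
    using assms unfolding mintegrable_def finite_moments_def
    by (auto intro!: set_integrable_sum set_integrable_bounded_linear[where T = "\<lambda>X. _ ** X ** _"])
qed

lemma winner_add_left:
  assumes "finite_moments x0 x1 W"
  shows "winner x0 x1 W (meval (P + Q)) (meval R) =
    winner x0 x1 W (meval P) (meval R) + winner x0 x1 W (meval Q) (meval R)"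
  using set_integral_add(2)[of lborel "einterval x0 x1" "inner_integrand W (meval P) (meval R)"
      "inner_integrand W (meval Q) (meval R)"] mintegrable_inner_integrand[OF assms]
  by (simp add: winner_def mintegrable_def) (simp add: inner_integrand_def meval_add mm.add_left)

lemma winner_mconst_mult_left:
  assumes "finite_moments x0 x1 W"
  shows "winner x0 x1 W (meval (mconst A ** P)) (meval Q) = A ** winner x0 x1 W (meval P) (meval Q)"
  using set_integral_bounded_linear[OF mm.bounded_linear_right, of lborel "einterval x0 x1"
      "inner_integrand W (meval P) (meval Q)" A] mintegrable_inner_integrand[OF assms]
  by (simp add: winner_def mintegrable_def)
    (simp add: inner_integrand_def meval_mult meval_mconst matrix_mul_assoc)

lemma winner_0_left: "winner x0 x1 W (meval 0) g = 0"
  by (simp add: winner_def inner_integrand_def[abs_def] meval_0 set_lebesgue_integral_def)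

lemma winner_sum_left:
  assumes "finite_moments x0 x1 W"
  shows "winner x0 x1 W (meval (\<Sum>k\<in>I. P k)) (meval R) = (\<Sum>k\<in>I. winner x0 x1 W (meval (P k)) (meval R))"
  by (induction I rule: infinite_finite_induct) (auto simp: winner_add_left[OF assms] winner_0_left)

text \<open>Integrability of both integrands provides the measurability that equality almost
  everywhere needs in order to give equal integrals.\<close>

lemma winner_cong_AE:
  assumes "mintegrable x0 x1 (inner_integrand W f g)" "mintegrable x0 x1 (inner_integrand W' f' g')"
    and "AE x in lborel. x \<in> einterval x0 x1 \<longrightarrow> inner_integrand W f g x = inner_integrand W' f' g' x"
  shows "winner x0 x1 W f g = winner x0 x1 W' f' g'"
  unfolding winner_def set_lebesgue_integral_def
  using assms unfolding mintegrable_def set_integrable_def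
  by (intro integral_cong_AE) (auto intro: borel_measurable_integrable elim!: eventually_mono split: split_indicator)

text \<open>\<open>W\<close> is Hermitian almost everywhere, so the adjoint of the integrand is the
  integrand with \<open>P\<close> and \<open>Q\<close> exchanged.\<close>

lemma winner_hermitian:
  assumes "weight_matrix x0 x1 W"
  shows "winner x0 x1 W (meval Q) (meval P) = hadj (winner x0 x1 W (meval P) (meval Q))"
proof -
  have fm: "finite_moments x0 x1 W" and "AE x in lborel. x \<in> einterval x0 x1 \<longrightarrow> pos_def (W x)"
    using assms by (auto simp: weight_matrix_def)
  then have AE: "AE x in lborel. x \<in> einterval x0 x1 \<longrightarrow> hadj (W x) = W x"
    by (auto simp: pos_def_def elim!: eventually_mono)
  have int: "set_integrable lborel (einterval x0 x1) (inner_integrand W (meval P) (meval Q))" for P Q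
    using mintegrable_inner_integrand[OF fm] by (simp add: mintegrable_def)
  note int' = set_integrable_bounded_linear[OF bounded_linear_hadj int, of P Q]
  have "hadj (winner x0 x1 W (meval P) (meval Q)) =
      (LINT x:einterval x0 x1|lborel. hadj (inner_integrand W (meval P) (meval Q) x))"
    unfolding winner_def by (rule set_integral_bounded_linear[OF bounded_linear_hadj int, symmetric])
  also have "\<dots> = winner x0 x1 W (meval Q) (meval P)"
    unfolding winner_def set_lebesgue_integral_def
    using int[of Q P] int' AE unfolding set_integrable_def
    by (intro integral_cong_AE)
      (auto intro: borel_measurable_integrable elim!: eventually_mono split: split_indicator
        simp: inner_integrand_def hadj_mult hadj_hadj matrix_mul_assoc)
  finally show ?thesis ..
qed


section \<open>Positive definiteness\<close>

lemma pos_def_invertible: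
  assumes "pos_def A"
  shows "invertible A"
  unfolding invertible_left_inverse matrix_left_invertible_ker
proof (intro allI impI)
  fix v assume v: "A *v v = 0"
  have "(\<Sum>i\<in>UNIV. \<Sum>j\<in>UNIV. cnj (v $ i) * A $ i $ j * v $ j) = (\<Sum>i\<in>UNIV. cnj (v $ i) * (A *v v) $ i)"
    by (simp add: matrix_vector_mult_def sum_distrib_left mult.assoc)
  also have "\<dots> = 0" by (simp add: v)
  finally have "\<not> 0 < Re (\<Sum>i\<in>UNIV. \<Sum>j\<in>UNIV. cnj (v $ i) * A $ i $ j * v $ j)"
    by (simp only: zero_complex.sel less_irrefl not_False_eq_True)
  then show "v = 0"
    using assms unfolding pos_def_def by blast
qed

lemma AE_reg_set:
  assumes "weight_matrix x0 x1 W"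
  shows "AE x in lborel. x \<in> einterval x0 x1 \<longrightarrow> x \<in> reg_set x0 x1 W"
proof -
  have "AE x in lborel. x \<in> einterval x0 x1 \<longrightarrow> pos_def (W x)"
    using assms by (auto simp: weight_matrix_def)
  then show ?thesis
    by (auto simp: reg_set_def pos_def_invertible elim!: eventually_mono)
qed

text \<open>A finite set is null, but a nonempty open interval is not. This serves both
  \<open>reg_set\<close> and the zero set of a polynomial.\<close>

lemma infinite_if_AE_einterval:
  assumes "x0 < x1" "AE x in lborel. x \<in> einterval x0 x1 \<longrightarrow> x \<in> X"
  shows "infinite X"
proof
  assume "finite X"
  then have "X \<in> null_sets lborel"
    by (rule finite_imp_null_set_lborel)
  then have "AE x in lborel. x \<notin> X"
    by (rule AE_not_in)
  with assms(2) have "AE x in lborel. x \<notin> einterval x0 x1"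
    by eventually_elim auto
  then have "einterval x0 x1 \<in> null_sets lborel"
    by (simp add: AE_iff_null_sets)
  then have "negligible (einterval x0 x1)"
    by (simp add: negligible_iff_null_sets null_sets_completionI)
  then show False
    using open_not_negligible[of "einterval x0 x1"] einterval_nonempty[OF assms(1)] by auto
qed

text \<open>The determinant of \<open>W\<close> is continuous. Openness matters because the product
  rule for operators involves derivatives at the points of the set.\<close>

lemma open_reg_set:
  assumes "weight_matrix x0 x1 W"
  shows "open (reg_set x0 x1 W)"
proof -
  have "smooth_on (einterval x0 x1) W"
    using assms by (simp add: weight_matrix_def)
  then have W: "continuous_on (einterval x0 x1) W"
    by (intro continuous_at_imp_continuous_on ballI differentiable_imp_continuous_within)
      (metis funpow_0 smooth_on_def)
  have "continuous_on (einterval x0 x1) (\<lambda>x. det (W x))"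
    unfolding det_def by (intro continuous_intros W)
  then have "open ((\<lambda>x. det (W x)) -` (- {0}) \<inter> einterval x0 x1)"
    by (subst (asm) continuous_on_open_vimage) auto
  also have "(\<lambda>x. det (W x)) -` (- {0}) \<inter> einterval x0 x1 = reg_set x0 x1 W"
    by (auto simp: reg_set_def invertible_det_nz)
  finally show ?thesis .
qed

lemma winner_self_eq_0:
  assumes "weight_matrix x0 x1 W" "winner x0 x1 W (meval R) (meval R) = 0"
  shows "R = 0"
proof -
  have fm: "finite_moments x0 x1 W" and pd: "AE x in lborel. x \<in> einterval x0 x1 \<longrightarrow> pos_def (W x)"
    and lt: "x0 < x1"
    using assms by (auto simp: weight_matrix_def)
  \<comment> \<open>The vector \<open>v x i\<close> is the conjugated row \<open>i\<close> of
    \<open>R\<close>, so that \<open>q x i\<close> is the quadratic form of \<open>pos_def\<close>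
    and the trace of \<open>R W R\<^sup>*\<close> is the sum of these forms.\<close>
  define v where "v x i = (\<chi> j. cnj (meval R x $ i $ j))" for x i
  define q where "q x i = Re (\<Sum>j\<in>UNIV. \<Sum>k\<in>UNIV. cnj (v x i $ j) * W x $ j $ k * v x i $ k)" for x i
  define T where "T A = (\<Sum>i\<in>UNIV. Re (A $ i $ i))" for A :: "'a cmat"
  have T: "bounded_linear T"
    unfolding T_def
    by (intro bounded_linear_sum bounded_linear_compose[OF bounded_linear_Re]
        bounded_linear_compose[OF bounded_linear_vec_nth bounded_linear_vec_nth])
  have Tq: "T (inner_integrand W (meval R) (meval R) x) = (\<Sum>i\<in>UNIV. q x i)" for x
    unfolding T_def q_def
  proof (intro sum.cong refl arg_cong[where f = Re])
    fix i
    show "inner_integrand W (meval R) (meval R) x $ i $ i =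
      (\<Sum>j\<in>UNIV. \<Sum>k\<in>UNIV. cnj (v x i $ j) * W x $ j $ k * v x i $ k)"
      unfolding inner_integrand_def v_def hadj_def matrix_matrix_mult_def transpose_def
      by (simp add: sum_distrib_right) (rule sum.swap)
  qed
  have q: "q x i \<ge> 0 \<and> (q x i = 0 \<longrightarrow> v x i = 0)" if "pos_def (W x)" for x i
    using that by (cases "v x i = 0") (force simp: pos_def_def q_def)+
  have int: "set_integrable lborel (einterval x0 x1) (inner_integrand W (meval R) (meval R))"
    using mintegrable_inner_integrand[OF fm] by (simp add: mintegrable_def)
  define h where "h x = indicator (einterval x0 x1) x *\<^sub>R (\<Sum>i\<in>UNIV. q x i)" for x
  have "integrable lborel h"
    using set_integrable_bounded_linear[OF T int] by (simp add: set_integrable_def Tq h_def[abs_def])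
  moreover have "AE x in lborel. 0 \<le> h x"
    using pd by eventually_elim (auto simp: h_def q intro!: sum_nonneg split: split_indicator)
  moreover have "integral\<^sup>L lborel h = 0"
    using set_integral_bounded_linear[OF T int] assms(2) linear_simps(3)[OF T]
    by (simp add: set_lebesgue_integral_def Tq h_def[abs_def] winner_def)
  ultimately have "AE x in lborel. h x = 0"
    by (simp add: integral_nonneg_eq_0_iff_AE)
  with pd have "AE x in lborel. x \<in> einterval x0 x1 \<longrightarrow> x \<in> {x. meval R x = 0}"
  proof eventually_elim
    case (elim x)
    show ?case
    proof
      assume x: "x \<in> einterval x0 x1"
      with elim have "(\<Sum>i\<in>UNIV. q x i) = 0"
        by (simp add: h_def)
      with x elim q have "q x i = 0" for i
        by (simp add: sum_nonneg_eq_0_iff)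
      with x elim q have "v x i = 0" for i
        by blast
      then show "x \<in> {x. meval R x = 0}"
        by (simp add: v_def vec_eq_iff)
    qed
  qed
  then have "infinite {x. meval R x = 0}"
    by (rule infinite_if_AE_einterval[OF lt])
  then show ?thesis
    by (rule pmat_eq_0_if_meval_infinite) simp
qed


section \<open>Symmetric operators\<close>

text \<open>Constants come out of the left argument, so \<open>Q\<close> is expanded there;
  Hermitian symmetry then exchanges the arguments.\<close>

lemma monic_orthogonal_lower_degree:
  assumes "weight_matrix x0 x1 W" "monic_orthogonal x0 x1 W P" "mdegree Q < n"
  shows "winner x0 x1 W (meval (P n)) (meval Q) = 0"
proof -
  have fm: "finite_moments x0 x1 W"
    using assms by (auto simp: weight_matrix_def)
  obtain C where C: "Q = (\<Sum>k\<le>mdegree Q. mconst (C k) ** P k)"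
    using monic_sequence_expansion[of P Q "mdegree Q"] assms(2) by (auto simp: monic_orthogonal_def)
  have "winner x0 x1 W (meval Q) (meval (P n)) = (\<Sum>k\<le>mdegree Q. C k ** winner x0 x1 W (meval (P k)) (meval (P n)))"
    by (subst C) (simp add: winner_sum_left[OF fm] winner_mconst_mult_left[OF fm])
  also have "\<dots> = 0"
    using assms(2,3) by (auto simp: monic_orthogonal_def mm.zero_right intro!: sum.neutral)
  finally show ?thesis
    using winner_hermitian[OF assms(1), of "P n" Q] linear_simps(3)[OF bounded_linear_hadj] by simp
qed

lemma alg_D_if_symmetric:
  assumes W: "weight_matrix x0 x1 W" and P: "monic_orthogonal x0 x1 W P"
    and deg: "\<And>Q n. mdegree Q \<le> n \<Longrightarrow> mdegree (pdop_act Q E) \<le> n"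
    and sym: "\<And>P Q. winner x0 x1 W (meval (pdop_act P E)) (meval Q) =
      winner x0 x1 W (meval P) (meval (pdop_act Q E))"
  shows "E \<in> alg_D x0 x1 W"
proof -
  have fm: "finite_moments x0 x1 W"
    using W by (auto simp: weight_matrix_def)
  have "pdop_act (P n) E = mconst (mcoeff (pdop_act (P n) E) n) ** P n" for n
  proof -
    define \<Lambda> where "\<Lambda> = mcoeff (pdop_act (P n) E) n"
    define R where "R = pdop_act (P n) E + mconst (- \<Lambda>) ** P n"
    have Pn: "mdegree (P n) = n" "mcoeff (P n) n = mat 1"
      using P by (auto simp: monic_orthogonal_def)
    have "mdegree R \<le> n"
      unfolding R_def by (intro mdegree_add_le mdegree_mconst_mult_le deg) (simp_all add: Pn)
    moreover have "mcoeff R n = 0"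
      by (simp add: R_def mcoeff_add mcoeff_mconst_mult Pn \<Lambda>_def)
    ultimately have "R = 0 \<or> mdegree R < n"
      by (rule pmat_eq_0_or_mdegree_less)
    then have "R = 0"
    proof
      assume R: "mdegree R < n"
      then have "mdegree (pdop_act R E) < n"
        using deg[of R "mdegree R"] by simp
      \<comment> \<open>Symmetry moves \<open>E\<close> to the right argument, so for
        \<open>Q = R\<close> both terms pair \<open>P n\<close> with polynomials of degree below
        \<open>n\<close>.\<close>
      moreover have "winner x0 x1 W (meval R) (meval Q) =
          winner x0 x1 W (meval (P n)) (meval (pdop_act Q E)) + (- \<Lambda>) ** winner x0 x1 W (meval (P n)) (meval Q)" for Q
        by (simp add: R_def winner_add_left[OF fm] winner_mconst_mult_left[OF fm] sym)
      ultimately have "winner x0 x1 W (meval R) (meval R) = 0"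
        using R by (simp add: monic_orthogonal_lower_degree[OF W P] mm.zero_right)
      then show ?thesis
        by (rule winner_self_eq_0[OF W])
    qed
    moreover have "mconst (- \<Lambda>) ** P n = - (mconst \<Lambda> ** P n)"
      by (simp add: mconst_def matrix_matrix_mult_def vec_eq_iff sum_negf)
    ultimately show ?thesis
      by (simp add: R_def \<Lambda>_def)
  qed
  with P show ?thesis
    unfolding alg_D_def by blast
qed

theorem theorem3p9:
  fixes x0 x1 :: ereal
    and W Wt :: "real \<Rightarrow> complex^'n::finite^'n"
    and V D :: "(complex poly^'n^'n) poly"
    and N :: "(real \<Rightarrow> complex^'n^'n) poly"
  assumes "weight_matrix x0 x1 W"
    and "weight_matrix x0 x1 Wt"
    and "strong_darboux x0 x1 W Wt"
    and "strong_darboux_transformer x0 x1 W Wt V"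
    and "N = darboux_N W Wt V"
    and "D \<in> alg_D x0 x1 W"
    and "dop_eq_on (reg_set x0 x1 W) (fdop V \<odot> N) (fdop D)"
  shows "\<forall>S \<in> sym_ops x0 x1 Wt.
           dop_mem_on (reg_set x0 x1 W) (fdop V \<odot> fdop S \<odot> N) (sym_ops x0 x1 W)"
proof
  fix S assume S: "S \<in> sym_ops x0 x1 Wt"
  define U where "U = reg_set x0 x1 W"
  have U: "open U"
    unfolding U_def by (rule open_reg_set[OF assms(1)])
  have AE: "AE x in lborel. x \<in> einterval x0 x1 \<longrightarrow> x \<in> U"
    unfolding U_def by (rule AE_reg_set[OF assms(1)])
  have fm: "finite_moments x0 x1 W" and "x0 < x1"
    using assms(1) by (auto simp: weight_matrix_def)
  then have inf: "infinite U"
    using infinite_if_AE_einterval AE by blast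
  have V: "degree_preserving V"
    and int: "mintegrable x0 x1 (inner_integrand W (meval P) (fdop_act (meval Q) N))"
    and adj: "winner x0 x1 Wt (meval (pdop_act P V)) (meval Q) = winner x0 x1 W (meval P) (fdop_act (meval Q) N)"
    for P Q
    using assms(4) by (auto simp: strong_darboux_transformer_def assms(5))

  have N: "\<exists>R. mdegree R \<le> n \<and> (\<forall>x\<in>U. fdop_act (meval Q) N x = meval R x)" if Q: "mdegree Q \<le> n" for Q n
  proof -
    obtain P where P: "mdegree P \<le> n" "pdop_act P V = Q"
      using degree_preserving_surj[OF V Q] by blast
    have "fdop_act (meval Q) N x = meval (pdop_act P D) x" if "x \<in> U" for x
      using fdop_act_fdop_dmult[OF U that, of P V N] that assms(7) P(2)
        fdop_act_dop_eq_on[of U "fdop V \<odot> N" "fdop D" x "meval P"]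
      by (simp add: U_def meval_pdop_act)
    then show ?thesis
      using alg_D_mdegree_le[OF assms(6) P(1)] by blast
  qed

  \<comment> \<open>Products associate to the left, so the operator in question is
    \<open>T \<odot> N\<close> with the polynomial left factor \<open>T\<close>.\<close>
  obtain T where T: "fdop V \<odot> fdop S = fdop T"
    and "\<And>P. meval (pdop_act P T) = meval (pdop_act (pdop_act P V) S)"
    using fdop_dmult by blast
  then have T_act: "pdop_act P T = pdop_act (pdop_act P V) S" for P
    using pmat_eq_if_meval_infinite[OF infinite_UNIV_char_0] by metis
  have L: "fdop_act (meval Q) (fdop T \<odot> N) x = fdop_act (meval (pdop_act Q T)) N x" if "x \<in> U" for Q x
    by (rule fdop_act_fdop_dmult[OF U that])
  have "\<exists>R. \<forall>x\<in>U. fdop_act (meval Q) (fdop T \<odot> N) x = meval R x" for Q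
    using N[of "pdop_act Q T", OF order_refl] L by auto
  then obtain E where E: "dop_eq_on U (fdop T \<odot> N) (fdop E)"
    using fdop_polynomial_coeffs by blast
  have E_act: "meval (pdop_act Q E) x = fdop_act (meval (pdop_act Q T)) N x" if "x \<in> U" for Q x
    using fdop_act_dop_eq_on[OF E that] L[OF that] by (simp add: meval_pdop_act)

  have deg: "mdegree (pdop_act Q E) \<le> n" if "mdegree Q \<le> n" for Q n
  proof -
    have "mdegree (pdop_act Q T) \<le> n"
      unfolding T_act using S V that
      by (auto simp: sym_ops_def degree_preserving_def intro!: alg_D_mdegree_le[of S x0 x1 Wt])
    then obtain R where R: "mdegree R \<le> n" "\<forall>x\<in>U. fdop_act (meval (pdop_act Q T)) N x = meval R x"
      using N by blast
    then have "pdop_act Q E = R"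
      by (intro pmat_eq_if_meval_infinite[OF inf]) (simp add: E_act)
    with R show ?thesis by simp
  qed

  \<comment> \<open>\<open>E\<close> is placed in the right argument because the adjoint relation
    has \<open>N\<close> there. The integrands agree on \<open>U\<close>, hence almost
    everywhere.\<close>
  have wE: "winner x0 x1 W (meval P) (meval (pdop_act Q E)) =
      winner x0 x1 Wt (meval (pdop_act P V)) (meval (pdop_act (pdop_act Q V) S))" for P Q
  proof -
    have "winner x0 x1 W (meval P) (meval (pdop_act Q E)) = winner x0 x1 W (meval P) (fdop_act (meval (pdop_act Q T)) N)"
      using AE by (intro winner_cong_AE mintegrable_inner_integrand[OF fm] int)
        (auto simp: inner_integrand_def E_act elim!: eventually_mono)
    then show ?thesis
      by (simp add: adj T_act)
  qed
  have sym: "winner x0 x1 W (meval (pdop_act P E)) (meval Q) = winner x0 x1 W (meval P) (meval (pdop_act Q E))" for P Q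
  proof -
    \<comment> \<open>With \<open>E\<close> on the left, the formula \<open>wE\<close> becomes
      available after exchanging the arguments; the exchange is undone for
      \<open>Wt\<close>.\<close>
    have "winner x0 x1 W (meval (pdop_act P E)) (meval Q) =
        hadj (winner x0 x1 Wt (meval (pdop_act Q V)) (meval (pdop_act (pdop_act P V) S)))"
      using winner_hermitian[OF assms(1), of "pdop_act P E" Q] by (simp add: wE)
    also have "\<dots> = winner x0 x1 Wt (meval (pdop_act (pdop_act P V) S)) (meval (pdop_act Q V))"
      by (rule winner_hermitian[OF assms(2), symmetric])
    also have "\<dots> = winner x0 x1 Wt (meval (pdop_act P V)) (meval (pdop_act (pdop_act Q V) S))"
      using S by (simp add: sym_ops_def)
    finally show ?thesis by (simp add: wE)
  qed

  \<comment> \<open>Membership in \<open>alg_D\<close> includes the existence of a monic orthogonal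
    sequence, so \<open>D\<close> supplies one for \<open>W\<close>.\<close>
  obtain P where "monic_orthogonal x0 x1 W P"
    using assms(6) by (auto simp: alg_D_def)
  then have "E \<in> alg_D x0 x1 W"
    using alg_D_if_symmetric[OF assms(1)] deg sym by blast
  with sym have "E \<in> sym_ops x0 x1 W"
    by (simp add: sym_ops_def)
  with E show "dop_mem_on (reg_set x0 x1 W) (fdop V \<odot> fdop S \<odot> N) (sym_ops x0 x1 W)"
    by (auto simp: dop_mem_on_def T U_def)
qed

end
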